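(* Let $K$ be a field, let $P=K[x_1,\dots,x_n]$, let $\mathfrak{M}=\langle x_1,\dots,x_n\rangle$, let $1\le s\le n$, and let $Z=(z_1,\dots,z_s)$ be a tuple of pairwise distinct indeterminates in $\{x_1,\dots,x_n\}$. Let $f_1,\dots,f_s\in\mathfrak{M}\setminus\{0\}$, let $F=(f_1,\dots,f_s)$, and assume that $z_i\in\mathrm{Supp}(f_i)$ for $i=1,\dots,s$. Then the following conditions are equivalent. (a) The tuple $F$ is $Z$-separating. (b) There exists a term ordering $\sigma$ on $\mathbb{N}^n$ such that its unique extension to $\mathbb{Z}^n$ satisfies $v>_\sigma 0$ for every $v\in\mathrm{DLog}_Z(F)$. (c) There exists a vector $u\in\mathbb{N}_+^n$ such that $u\cdot v>0$ for every $v\in\mathrm{DLog}_Z(F)$, where $u\cdot v$ denotes the dot product.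
   Context: $\mathbb{N}_+$ is the set of positive integers. A term is a power product $t=x_1^{\alpha_1}\cdots x_n^{\alpha_n}$, and its logarithm is $\log(t)=(\alpha_1,\dots,\alpha_n)\in\mathbb{N}^n$. $\mathrm{Supp}(f)$ is the set of terms occurring in $f$ with nonzero coefficient. A term ordering on the monoid of terms $\mathbb{T}^n$ (a multiplicative total well-ordering) is identified via $\log$ with a term ordering on the additive monoid $\mathbb{N}^n$; it extends uniquely to a total ordering on $\mathbb{Z}^n$ compatible with addition. $\mathrm{LT}_\sigma(f)$ denotes the $\sigma$-largest term in $\mathrm{Supp}(f)$. The tuple $F$ is $Z$-separating if there is a term ordering $\sigma$ with $\mathrm{LT}_\sigma(f_i)=z_i$ for $i=1,\dots,s$. The set of logarithmic differences of $f_i$ with respect to $z_i$ is $\mathrm{DLog}_{z_i}(f_i)=\{\log(z_i)-\log(t)\mid t\in\mathrm{Supp}(f_i)\setminus\{z_i\}\}\subseteq\mathbb{Z}^n$, and the set of logarithmic differences of $F$ with respect to $Z$ is $\mathrm{DLog}_Z(F)=\bigcup_{i=1}^s\mathrm{DLog}_{z_i}(f_i)$. *)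

theory Defs
  imports "HOL-Library.Poly_Mapping" "HOL-Analysis.Finite_Cartesian_Product"
begin

text \<open>
  The indeterminates are indexed by a finite type \<open>'n\<close>, so that the number of indeterminates is
  \<open>CARD('n)\<close>. A term is represented by its logarithm, a vector in \<open>nat ^ 'n\<close>; the monoid of terms
  is therefore written additively. A polynomial is a finitely supported function from terms to
  coefficients, with the convolution product of \<open>Poly_Mapping\<close>.
\<close>

type_synonym 'n pterm = "nat ^ 'n"
type_synonym ('n, 'k) polyn = "(nat ^ 'n) \<Rightarrow>\<^sub>0 'k"

abbreviation Supp :: "('n::finite, 'k::zero) polyn \<Rightarrow> 'n pterm set" where
  "Supp f \<equiv> Poly_Mapping.keys f"

definition indet :: "'n::finite \<Rightarrow> 'n pterm" where
  "indet j = axis j 1"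

text \<open>The ideal generated by all indeterminates (the span in the ring as a module over itself).\<close>

definition irrelevant_ideal :: "('n::finite, 'k::field) polyn set" where
  "irrelevant_ideal = module.span (*) (range (\<lambda>j. Poly_Mapping.single (indet j) 1))"

lemma module_polyn: "module ((*) :: ('n::finite, 'k::field) polyn \<Rightarrow> _ \<Rightarrow> _)"
  by unfold_locales (simp_all add: algebra_simps)

definition translation_compatible :: "'a::plus rel \<Rightarrow> bool" where
  "translation_compatible r \<longleftrightarrow> (\<forall>a b c. (a, b) \<in> r \<longrightarrow> (a + c, b + c) \<in> r)"

text \<open>Orderings are reflexive relations; \<open>(a, b) \<in> \<sigma>\<close> means \<open>a \<le>\<^sub>\<sigma> b\<close>.\<close>

definition term_ordering :: "'n::finite pterm rel \<Rightarrow> bool" where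
  "term_ordering \<sigma> \<longleftrightarrow> well_order_on UNIV \<sigma> \<and> translation_compatible \<sigma>"

definition LT :: "'n::finite pterm rel \<Rightarrow> ('n, 'k::field) polyn \<Rightarrow> 'n pterm" where
  "LT \<sigma> f = (THE t. t \<in> Supp f \<and> (\<forall>t'\<in>Supp f. (t', t) \<in> \<sigma>))"

definition Z_separating ::
    "nat \<Rightarrow> (nat \<Rightarrow> 'n::finite pterm) \<Rightarrow> (nat \<Rightarrow> ('n, 'k::field) polyn) \<Rightarrow> bool" where
  "Z_separating s z f \<longleftrightarrow> (\<exists>\<sigma>. term_ordering \<sigma> \<and> (\<forall>i\<in>{1..s}. LT \<sigma> (f i) = z i))"

definition to_int_vec :: "nat ^ 'n::finite \<Rightarrow> int ^ 'n" where
  "to_int_vec a = (\<chi> j. int (a $ j))"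

definition is_int_extension :: "'n::finite pterm rel \<Rightarrow> (int ^ 'n) rel \<Rightarrow> bool" where
  "is_int_extension \<sigma> \<tau> \<longleftrightarrow> linear_order_on UNIV \<tau> \<and> translation_compatible \<tau> \<and>
     (\<forall>a b. (to_int_vec a, to_int_vec b) \<in> \<tau> \<longleftrightarrow> (a, b) \<in> \<sigma>)"

text \<open>For a term ordering, the extension exists and is unique: see \<open>ex1_int_extension\<close> below.\<close>

definition int_extension :: "'n::finite pterm rel \<Rightarrow> (int ^ 'n) rel" where
  "int_extension \<sigma> = (THE \<tau>. is_int_extension \<sigma> \<tau>)"

definition DLog_at :: "'n::finite pterm \<Rightarrow> ('n, 'k::field) polyn \<Rightarrow> (int ^ 'n) set" where
  "DLog_at z f = {to_int_vec z - to_int_vec t | t. t \<in> Supp f - {z}}"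

definition DLog ::
    "nat \<Rightarrow> (nat \<Rightarrow> 'n::finite pterm) \<Rightarrow> (nat \<Rightarrow> ('n, 'k::field) polyn) \<Rightarrow> (int ^ 'n) set" where
  "DLog s z f = (\<Union>i\<in>{1..s}. DLog_at (z i) (f i))"

definition dot :: "int ^ 'n::finite \<Rightarrow> int ^ 'n \<Rightarrow> int" where
  "dot u v = (\<Sum>j\<in>UNIV. u $ j * v $ j)"

lemma to_int_vec_add: "to_int_vec (a + b) = to_int_vec a + to_int_vec b"
  by (simp add: to_int_vec_def vec_eq_iff)

lemma to_int_vec_inject: "to_int_vec a = to_int_vec b \<longleftrightarrow> a = b"
  by (simp add: to_int_vec_def vec_eq_iff)

lemma int_vec_diff_cases:
  obtains a b where "v = to_int_vec a - to_int_vec b"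
proof
  show "v = to_int_vec (\<chi> j. nat (v $ j)) - to_int_vec (\<chi> j. nat (- v $ j))"
    by (auto simp: to_int_vec_def vec_eq_iff)
qed

lemma translation_compatibleD:
  "translation_compatible r \<Longrightarrow> (a, b) \<in> r \<Longrightarrow> (a + c, b + c) \<in> r"
  by (simp add: translation_compatible_def)

lemma term_orderingD:
  assumes "term_ordering \<sigma>"
  shows "(a, a) \<in> \<sigma>"
    and "(a, b) \<in> \<sigma> \<Longrightarrow> (b, c) \<in> \<sigma> \<Longrightarrow> (a, c) \<in> \<sigma>"
    and "(a, b) \<in> \<sigma> \<Longrightarrow> (b, a) \<in> \<sigma> \<Longrightarrow> a = b"
    and "(a, b) \<in> \<sigma> \<or> (b, a) \<in> \<sigma>"
    and "translation_compatible \<sigma>"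
proof -
  have o: "refl \<sigma>" "trans \<sigma>" "antisym \<sigma>" "total \<sigma>" "translation_compatible \<sigma>"
    using assms
    by (simp_all add: term_ordering_def well_order_on_def order_on_defs)
  show "(a, a) \<in> \<sigma>" using o(1) by (rule reflD)
  show "(a, b) \<in> \<sigma> \<Longrightarrow> (b, c) \<in> \<sigma> \<Longrightarrow> (a, c) \<in> \<sigma>" using o(2) by (rule transD)
  show "(a, b) \<in> \<sigma> \<Longrightarrow> (b, a) \<in> \<sigma> \<Longrightarrow> a = b" using o(3) by (rule antisymD)
  show "(a, b) \<in> \<sigma> \<or> (b, a) \<in> \<sigma>"
    using o(4) \<open>(a, a) \<in> \<sigma>\<close> by (cases "a = b") (auto simp: total_on_def)
  show "translation_compatible \<sigma>" by fact
qed

lemma term_ordering_cancel: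
  assumes "term_ordering \<sigma>" and "(a + c, b + c) \<in> \<sigma>"
  shows "(a, b) \<in> \<sigma>"
  using term_orderingD(4)[OF assms(1), of a b]
proof
  assume "(b, a) \<in> \<sigma>"
  then have "(b + c, a + c) \<in> \<sigma>"
    by (rule translation_compatibleD[OF term_orderingD(5)[OF assms(1)]])
  then have "a + c = b + c" by (rule term_orderingD(3)[OF assms])
  then show ?thesis using term_orderingD(1)[OF assms(1)] by simp
qed

lemma ex1_int_extension:
  fixes \<sigma> :: "'n::finite pterm rel"
  assumes "term_ordering \<sigma>"
  shows "\<exists>!\<tau>. is_int_extension \<sigma> \<tau>"
proof
  note rf = term_orderingD(1)[OF assms] and tr = term_orderingD(2)[OF assms]
    and an = term_orderingD(3)[OF assms] and tot = term_orderingD(4)[OF assms]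
    and tc = term_orderingD(5)[OF assms]
  define \<tau> where "\<tau> = {(v, w). \<exists>a b. v - w = to_int_vec a - to_int_vec b \<and> (a, b) \<in> \<sigma>}"
  have eq: "(a, b) \<in> \<sigma>"
    if "to_int_vec a - to_int_vec b = to_int_vec c - to_int_vec d" "(c, d) \<in> \<sigma>" for a b c d
  proof -
    have "to_int_vec (a + d) = to_int_vec (c + b)"
      using that(1) by (simp add: to_int_vec_add algebra_simps)
    then have e: "a + d = b + c" by (simp add: to_int_vec_inject add.commute)
    have "(c + b, d + b) \<in> \<sigma>" using that(2) tc by (simp add: translation_compatibleD)
    then have "(a + d, b + d) \<in> \<sigma>" by (simp add: e add.commute)
    then show ?thesis using assms term_ordering_cancel by blast
  qed
  have tau: "(v, w) \<in> \<tau> \<longleftrightarrow> (a, b) \<in> \<sigma>" if "v - w = to_int_vec a - to_int_vec b" for v w a b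
    unfolding \<tau>_def using that eq by auto
  have "refl \<tau>" using rf tau by (auto simp: refl_on_def intro: tau[of _ _ 0 0, THEN iffD2])
  moreover have "trans \<tau>"
  proof (rule transI)
    fix u v w assume "(u, v) \<in> \<tau>" "(v, w) \<in> \<tau>"
    then obtain a b c d where *: "u - v = to_int_vec a - to_int_vec b" "(a, b) \<in> \<sigma>"
      "v - w = to_int_vec c - to_int_vec d" "(c, d) \<in> \<sigma>" unfolding \<tau>_def by auto
    have "u - w = (u - v) + (v - w)" by simp
    also have "\<dots> = to_int_vec (a + c) - to_int_vec (b + d)"
      unfolding *(1,3) by (simp add: to_int_vec_add)
    finally have "u - w = to_int_vec (a + c) - to_int_vec (b + d)" .
    moreover have "(a + c, b + d) \<in> \<sigma>"
      using tr[of "a + c" "b + c" "b + d"] translation_compatibleD[OF tc *(2), of c]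
        translation_compatibleD[OF tc *(4), of b] by (simp add: add.commute)
    ultimately show "(u, w) \<in> \<tau>" using tau by blast
  qed
  moreover have "antisym \<tau>"
  proof (rule antisymI)
    fix v w assume *: "(v, w) \<in> \<tau>" "(w, v) \<in> \<tau>"
    obtain a b where ab: "v - w = to_int_vec a - to_int_vec b" by (rule int_vec_diff_cases)
    then have ba: "w - v = to_int_vec b - to_int_vec a" by (metis minus_diff_eq)
    have "a = b" using * an tau[OF ab] tau[OF ba] by blast
    with ab show "v = w" by simp
  qed
  moreover have "total \<tau>"
  proof (rule total_onI)
    fix v w :: "int ^ 'n"
    obtain a b where ab: "v - w = to_int_vec a - to_int_vec b" by (rule int_vec_diff_cases)
    then have ba: "w - v = to_int_vec b - to_int_vec a" by (metis minus_diff_eq)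
    show "(v, w) \<in> \<tau> \<or> (w, v) \<in> \<tau>" using tot tau[OF ab] tau[OF ba] by blast
  qed
  ultimately have "linear_order_on UNIV \<tau>"
    by (simp add: linear_order_on_def partial_order_on_def preorder_on_def)
  moreover have "translation_compatible \<tau>"
    by (auto simp: translation_compatible_def \<tau>_def)
  ultimately show "is_int_extension \<sigma> \<tau>"
    using tau by (auto simp: is_int_extension_def)
  fix \<rho> assume r: "is_int_extension \<sigma> \<rho>"
  then have rc: "translation_compatible \<rho>"
    and re: "\<And>a b. (to_int_vec a, to_int_vec b) \<in> \<rho> \<longleftrightarrow> (a, b) \<in> \<sigma>"
    by (auto simp: is_int_extension_def)
  have "(v, w) \<in> \<rho> \<longleftrightarrow> (v, w) \<in> \<tau>" for v w
  proof -
    obtain a b where ab: "v - w = to_int_vec a - to_int_vec b" by (rule int_vec_diff_cases)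
    define c where "c = to_int_vec b - w"
    have *: "v + c = to_int_vec a" "w + c = to_int_vec b"
      using ab by (simp_all add: c_def algebra_simps)
    have "(v, w) \<in> \<rho> \<longleftrightarrow> (v + c, w + c) \<in> \<rho>"
      using translation_compatibleD[OF rc, of v w c]
        translation_compatibleD[OF rc, of "v + c" "w + c" "- c"] by auto
    then show ?thesis using * re tau[OF ab] by simp
  qed
  then show "\<rho> = \<tau>" by auto
qed

end

theory Submission
  imports Defs "HOL-Library.Fun_Lexorder"
begin

text \<open>
  Conditions (a) and (b) say the same thing: under the extension of \<open>\<sigma>\<close>, the difference
  \<open>log z - log t\<close> is positive exactly when \<open>t\<close> is strictly smaller than \<open>z\<close>
  (lemma \<open>LT_eq_iff_DLog_at_positive\<close>).

  From (c) to (b): order terms first by the weight \<open>u \<bullet> a\<close> and break ties lexicographically.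
  Since all entries of \<open>u\<close> are positive, only finitely many terms have a given weight, so this is
  a well-ordering (lemma \<open>term_ordering_weighted_lex\<close>).

  From (b) to (c): the vectors of \<open>DLog\<close> and the unit vectors form a finite set of elements that
  are positive in the ordered group of integer vectors. For any such set there is a linear
  functional that is positive on all of its members. This is the nontrivial step; it is proved by
  Fourier-Motzkin elimination over the rationals, one coordinate at a time (lemma
  \<open>ex_rat_functional_positive\<close>). Each elimination step only forms positive integer combinations,
  so it stays within the positive cone of the ordering and never produces the zero vector.
  Clearing denominators then gives \<open>u\<close>, and the unit vectors force its entries to be positive.
\<close>

section \<open>Functionals that are positive on a finite set of positive vectors\<close>

lemma ex_strictly_between_finite_sets:
  fixes L H :: "'a::linordered_field set"
  assumes "finite L" "finite H" and "\<And>l h. l \<in> L \<Longrightarrow> h \<in> H \<Longrightarrow> l < h"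
  shows "\<exists>c. (\<forall>l\<in>L. l < c) \<and> (\<forall>h\<in>H. c < h)"
proof (cases "L = {}")
  case True
  show ?thesis
  proof (cases "H = {}")
    case True
    with \<open>L = {}\<close> show ?thesis by simp
  next
    case False
    obtain c where "c < Min H" using lt_ex by blast
    with False True assms(2) show ?thesis by (auto intro!: exI[of _ c])
  qed
next
  case L: False
  show ?thesis
  proof (cases "H = {}")
    case True
    obtain c where "Max L < c" using gt_ex by blast
    with L True assms(1) show ?thesis by (auto intro!: exI[of _ c])
  next
    case False
    have "Max L < Min H" using assms L False by simp
    then obtain c where "Max L < c" "c < Min H" using dense by blast
    with L False assms(1,2) show ?thesis by (auto intro!: exI[of _ c])
  qed
qed

lemma additive_predicate_scale:
  fixes P :: "int ^ 'n \<Rightarrow> bool"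
  assumes add: "\<And>v w. P v \<Longrightarrow> P w \<Longrightarrow> P (v + w)" and "P v" and "0 < k"
  shows "P (k *s v)"
  using \<open>0 < k\<close>
proof (induction k rule: int_gr_induct)
  case base
  have "(1::int) *s v = v" by (simp add: vec_eq_iff)
  then show ?case using \<open>P v\<close> by simp
next
  case (step k)
  have "(k + 1) *s v = k *s v + v" by (simp add: vec_eq_iff algebra_simps)
  then show ?case using add step.IH \<open>P v\<close> by simp
qed

text \<open>
  Fourier-Motzkin elimination for the positive cone \<open>P\<close> of an ordering. The induction runs over
  the set \<open>S\<close> of coordinates in which the vectors may be nonzero. Only closure of \<open>P\<close> under
  addition and \<open>0 \<notin> P\<close> are needed.
\<close>

lemma ex_rat_functional_positive:
  fixes P :: "int ^ 'n::finite \<Rightarrow> bool" and S :: "'n set"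
  assumes add: "\<And>v w. P v \<Longrightarrow> P w \<Longrightarrow> P (v + w)" and zero: "\<not> P 0"
    and "finite D" and "\<And>v. v \<in> D \<Longrightarrow> P v"
    and "\<And>v j. v \<in> D \<Longrightarrow> j \<notin> S \<Longrightarrow> v $ j = 0"
  shows "\<exists>u :: 'n \<Rightarrow> rat. \<forall>v\<in>D. 0 < (\<Sum>j\<in>S. u j * of_int (v $ j))"
  using finite[of S] assms(3-)
proof (induction S arbitrary: D rule: finite_induct)
  case empty
  have "v = 0" if "v \<in> D" for v using empty(3)[OF that] by (simp add: vec_eq_iff)
  then have "D = {}" using empty(2) zero by blast
  then show ?case by simp
next
  case (insert i S)
  \<comment> \<open>If the \<open>i\<close>-th entry of \<open>v\<close> is positive and that of \<open>w\<close> is negative, \<open>E v w\<close> is a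
     positive combination in which these entries cancel.\<close>
  define E where "E v w = (- w $ i) *s v + (v $ i) *s w" for v w :: "int ^ 'n"
  define Dp where "Dp = {v \<in> D. 0 < v $ i}"
  define Dn where "Dn = {v \<in> D. v $ i < 0}"
  define D' where "D' = {v \<in> D. v $ i = 0} \<union> (\<lambda>(v, w). E v w) ` (Dp \<times> Dn)"
  have fin: "finite Dp" "finite Dn" "finite D'"
    using insert.prems(1) by (simp_all add: Dp_def Dn_def D'_def)
  have "P (E v w)" if "v \<in> Dp" "w \<in> Dn" for v w
    unfolding E_def using that insert.prems(2)
    by (intro add additive_predicate_scale[of P]) (simp_all add: Dp_def Dn_def add)
  then have P': "P v" if "v \<in> D'" for v
    using that insert.prems(2) by (auto simp: D'_def)
  have zero': "v $ j = 0" if "v \<in> D'" "j \<notin> S" for v j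
    using that insert.prems(3) by (cases "j = i") (auto simp: D'_def E_def Dp_def Dn_def)
  obtain u where u: "\<And>v. v \<in> D' \<Longrightarrow> 0 < (\<Sum>j\<in>S. u j * rat_of_int (v $ j))"
    using insert.IH[OF fin(3) P' zero'] by blast
  define g where "g v = (\<Sum>j\<in>S. u j * rat_of_int (v $ j))" for v
  have gE: "g (E v w) = of_int (- w $ i) * g v + of_int (v $ i) * g w" for v w
    by (simp add: g_def E_def sum_distrib_left sum.distrib[symmetric] sum_negf[symmetric]
        algebra_simps)
  \<comment> \<open>The \<open>i\<close>-th entry \<open>c\<close> of the functional is subject to one lower bound for each vector
     in \<open>Dp\<close> and one upper bound for each vector in \<open>Dn\<close>.\<close>
  have "\<exists>c. (\<forall>l\<in>(\<lambda>v. - g v / of_int (v $ i)) ` Dp. l < c) \<and>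
            (\<forall>h\<in>(\<lambda>v. - g v / of_int (v $ i)) ` Dn. c < h)"
  proof (rule ex_strictly_between_finite_sets)
    fix l h assume "l \<in> (\<lambda>v. - g v / of_int (v $ i)) ` Dp" "h \<in> (\<lambda>v. - g v / of_int (v $ i)) ` Dn"
    then obtain v w where vw: "v \<in> Dp" "w \<in> Dn"
      and l: "l = - g v / of_int (v $ i)" and h: "h = - g w / of_int (w $ i)" by blast
    have "E v w \<in> D'" using vw by (force simp: D'_def)
    then have "0 < g (E v w)" using u by (simp add: g_def)
    then have "0 < of_int (- w $ i) * g v + of_int (v $ i) * g w" unfolding gE .
    moreover have "0 < rat_of_int (v $ i)" "rat_of_int (w $ i) < 0"
      using vw by (simp_all add: Dp_def Dn_def)
    ultimately show "l < h" unfolding l h by (simp add: field_simps)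
  qed (use fin in simp_all)
  then obtain c where "\<forall>v\<in>Dp. - g v / of_int (v $ i) < c" "\<forall>v\<in>Dn. c < - g v / of_int (v $ i)"
    unfolding ball_simps by blast
  then have c: "\<And>v. v \<in> Dp \<Longrightarrow> - g v / of_int (v $ i) < c"
    "\<And>v. v \<in> Dn \<Longrightarrow> c < - g v / of_int (v $ i)" by blast+
  have sum: "(\<Sum>j\<in>insert i S. (u(i := c)) j * of_int (v $ j)) = c * of_int (v $ i) + g v" for v
    using insert.hyps by (auto simp: g_def intro!: sum.cong)
  have "0 < c * of_int (v $ i) + g v" if "v \<in> D" for v
  proof -
    consider "v $ i = 0" | "0 < v $ i" | "v $ i < 0" by linarith
    then show ?thesis
    proof cases
      case 1
      then show ?thesis using u[of v] that by (simp add: D'_def g_def)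
    next
      case 2
      then have "v \<in> Dp" "0 < rat_of_int (v $ i)" using that by (simp_all add: Dp_def)
      then show ?thesis using c(1)[of v] by (simp add: field_simps)
    next
      case 3
      then have "v \<in> Dn" "rat_of_int (v $ i) < 0" using that by (simp_all add: Dn_def)
      then show ?thesis using c(2)[of v] by (simp add: field_simps)
    qed
  qed
  then show ?case unfolding sum[symmetric] by (intro exI[of _ "u(i := c)"] ballI)
qed

lemma clear_denominators:
  fixes u :: "'a::finite \<Rightarrow> rat"
  obtains N :: int and m :: "'a \<Rightarrow> int" where "0 < N" "\<And>j. of_int (m j) = of_int N * u j"
proof -
  define N where "N = (\<Prod>j\<in>UNIV. snd (quotient_of (u j)))"
  have "0 < N" unfolding N_def by (intro prod_pos) (simp add: quotient_of_denom_pos')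
  moreover have "\<exists>m. of_int m = of_int N * u j" for j
  proof -
    define p where "p = fst (quotient_of (u j))"
    define q where "q = snd (quotient_of (u j))"
    have "q \<noteq> 0" "u j = of_int p / of_int q"
      using quotient_of_div[of "u j" p q] quotient_of_denom_pos'[of "u j"]
      by (simp_all add: p_def q_def)
    moreover have "N = q * (\<Prod>j\<in>UNIV - {j}. snd (quotient_of (u j)))"
      unfolding N_def q_def by (rule prod.remove) simp_all
    ultimately have "of_int (p * (\<Prod>j\<in>UNIV - {j}. snd (quotient_of (u j)))) = of_int N * u j"
      by simp
    then show ?thesis by blast
  qed
  ultimately show thesis using that by metis
qed

lemma ex_int_functional_positive:
  fixes P :: "int ^ 'n::finite \<Rightarrow> bool"
  assumes "\<And>v w. P v \<Longrightarrow> P w \<Longrightarrow> P (v + w)" and "\<not> P 0"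
    and "finite D" and "\<And>v. v \<in> D \<Longrightarrow> P v"
  shows "\<exists>u. \<forall>v\<in>D. 0 < dot u v"
proof -
  have "\<exists>u. \<forall>v\<in>D. 0 < (\<Sum>j\<in>UNIV. u j * rat_of_int (v $ j))"
    by (rule ex_rat_functional_positive[of P]) (use assms in simp_all)
  then obtain u where u: "\<And>v. v \<in> D \<Longrightarrow> 0 < (\<Sum>j\<in>UNIV. u j * rat_of_int (v $ j))"
    by blast
  obtain N m where N: "0 < N" and m: "\<And>j. rat_of_int (m j) = of_int N * u j"
    using clear_denominators[of u] by blast
  have "0 < dot (\<chi> j. m j) v" if "v \<in> D" for v
  proof -
    have "rat_of_int (dot (\<chi> j. m j) v) = of_int N * (\<Sum>j\<in>UNIV. u j * rat_of_int (v $ j))"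
      by (simp add: dot_def m sum_distrib_left mult.assoc)
    then have "0 < rat_of_int (dot (\<chi> j. m j) v)" using u[OF that] N by simp
    then show ?thesis by simp
  qed
  then show ?thesis by blast
qed

section \<open>Term orderings and their extension to integer vectors\<close>

lemma int_extension_diff_iff:
  assumes "term_ordering \<sigma>"
  shows "(0, to_int_vec b - to_int_vec a) \<in> int_extension \<sigma> \<longleftrightarrow> (a, b) \<in> \<sigma>"
proof -
  have "is_int_extension \<sigma> (int_extension \<sigma>)"
    unfolding int_extension_def by (rule theI'[OF ex1_int_extension[OF assms]])
  then have tc: "translation_compatible (int_extension \<sigma>)"
    and ext: "(to_int_vec a, to_int_vec b) \<in> int_extension \<sigma> \<longleftrightarrow> (a, b) \<in> \<sigma>"
    by (auto simp: is_int_extension_def)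
  show ?thesis
    using translation_compatibleD[OF tc, of 0 "to_int_vec b - to_int_vec a" "to_int_vec a"]
      translation_compatibleD[OF tc, of "to_int_vec a" "to_int_vec b" "- to_int_vec a"] ext
    by auto
qed

lemma int_extension_positive_add:
  assumes "term_ordering \<sigma>"
    and "(0, v) \<in> int_extension \<sigma> \<and> v \<noteq> 0" and "(0, w) \<in> int_extension \<sigma> \<and> w \<noteq> 0"
  shows "(0, v + w) \<in> int_extension \<sigma> \<and> v + w \<noteq> 0"
proof -
  have "is_int_extension \<sigma> (int_extension \<sigma>)"
    unfolding int_extension_def by (rule theI'[OF ex1_int_extension[OF assms(1)]])
  then have tc: "translation_compatible (int_extension \<sigma>)"
    and tr: "trans (int_extension \<sigma>)" and an: "antisym (int_extension \<sigma>)"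
    by (auto simp: is_int_extension_def order_on_defs)
  have vw: "(w, v + w) \<in> int_extension \<sigma>"
    using translation_compatibleD[OF tc, of 0 v w] assms(2) by simp
  then have "(0, v + w) \<in> int_extension \<sigma>" using assms(3) transD[OF tr] by blast
  moreover have "v + w \<noteq> 0" using vw assms(3) antisymD[OF an] by metis
  ultimately show ?thesis ..
qed

lemma term_ordering_zero_least:
  assumes "term_ordering \<sigma>"
  shows "(0, a) \<in> \<sigma>"
proof -
  have "wf (\<sigma> - Id)" using assms by (simp add: term_ordering_def well_order_on_def)
  then obtain m where m: "\<And>b. (b, m) \<notin> \<sigma> - Id"
    by (rule wfE_min[where Q = UNIV and x = 0]) auto
  then have least: "(m, b) \<in> \<sigma>" for b
    using term_orderingD(1,4)[OF assms] by (cases "b = m") blast+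
  \<comment> \<open>Translating \<open>m \<le> 0\<close> by \<open>m\<close> shows that \<open>2m\<close> is not larger than the least element \<open>m\<close>.\<close>
  have "(m + m, m) \<in> \<sigma>"
    using translation_compatibleD[OF term_orderingD(5)[OF assms] least[of 0], of m] by simp
  then have "m + m = m" using m by blast
  then have "m = 0" by simp
  then show ?thesis using least by simp
qed

lemma LT_eq_iff:
  assumes "term_ordering \<sigma>" and "t \<in> Supp f"
  shows "LT \<sigma> f = t \<longleftrightarrow> (\<forall>t'\<in>Supp f. (t', t) \<in> \<sigma>)"
proof
  assume "\<forall>t'\<in>Supp f. (t', t) \<in> \<sigma>"
  then show "LT \<sigma> f = t"
    unfolding LT_def using assms term_orderingD(3)[OF assms(1)] by (intro the_equality) blast+
next
  assume t: "LT \<sigma> f = t"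
  have "\<exists>m\<in>A. \<forall>t'\<in>A. (t', m) \<in> \<sigma>" if "finite A" "A \<noteq> {}" for A
    using that
  proof (induction rule: finite_ne_induct)
    case (singleton x)
    then show ?case using term_orderingD(1)[OF assms(1)] by simp
  next
    case (insert x A)
    then obtain m where m: "m \<in> A" "\<forall>t'\<in>A. (t', m) \<in> \<sigma>" by blast
    show ?case
    proof (cases "(x, m) \<in> \<sigma>")
      case True
      then show ?thesis using m by blast
    next
      case False
      then have "(m, x) \<in> \<sigma>" using term_orderingD(4)[OF assms(1)] by blast
      then show ?thesis using m term_orderingD(1,2)[OF assms(1)] by blast
    qed
  qed
  then obtain m where m: "m \<in> Supp f" "\<forall>t'\<in>Supp f. (t', m) \<in> \<sigma>"
    using assms(2) finite_keys[of f] by blast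
  then have "LT \<sigma> f = m"
    unfolding LT_def using term_orderingD(3)[OF assms(1)] by (intro the_equality) blast+
  with t m show "\<forall>t'\<in>Supp f. (t', t) \<in> \<sigma>" by simp
qed

lemma LT_eq_iff_DLog_at_positive:
  assumes "term_ordering \<sigma>" and "t \<in> Supp f"
  shows "LT \<sigma> f = t \<longleftrightarrow> (\<forall>v\<in>DLog_at t f. (0, v) \<in> int_extension \<sigma> \<and> v \<noteq> 0)"
proof -
  have "(\<forall>v\<in>DLog_at t f. (0, v) \<in> int_extension \<sigma> \<and> v \<noteq> 0) \<longleftrightarrow>
      (\<forall>t'\<in>Supp f - {t}. (t', t) \<in> \<sigma>)"
    by (auto simp: DLog_at_def int_extension_diff_iff[OF assms(1)] to_int_vec_inject)
  also have "\<dots> \<longleftrightarrow> (\<forall>t'\<in>Supp f. (t', t) \<in> \<sigma>)"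
    using term_orderingD(1)[OF assms(1)] by blast
  finally show ?thesis using LT_eq_iff[OF assms] by simp
qed

lemma finite_DLog: "finite (DLog s z f)"
proof -
  have "DLog_at t g = (\<lambda>t'. to_int_vec t - to_int_vec t') ` (Supp g - {t})"
    for t :: "'a pterm" and g :: "('a, 'b) polyn"
    by (auto simp: DLog_at_def)
  then show ?thesis by (simp add: DLog_def)
qed

section \<open>The weighted lexicographic ordering\<close>

text \<open>The weight \<open>u \<bullet> a\<close> of a term \<open>a\<close>.\<close>

definition weight :: "nat ^ 'n::finite \<Rightarrow> 'n pterm \<Rightarrow> nat" where
  "weight u a = (\<Sum>j\<in>UNIV. u $ j * a $ j)"

text \<open>
  The key of a term with respect to an enumeration \<open>e\<close> of the indeterminates: its weight, followed
  by its exponents, padded with zeros. Comparing keys lexicographically compares the weight first.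
\<close>

definition weight_key :: "nat ^ 'n::finite \<Rightarrow> (nat \<Rightarrow> 'n) \<Rightarrow> 'n pterm \<Rightarrow> nat \<Rightarrow> nat" where
  "weight_key u e a =
     (\<lambda>i. case i of 0 \<Rightarrow> weight u a | Suc k \<Rightarrow> if k < CARD('n) then a $ e k else 0)"

text \<open>
  The reflexive lexicographic ordering of terms by their keys. It is antisymmetric because
  \<open>less_fun\<close> is asymmetric; it is total when \<open>e\<close> enumerates all indeterminates, since then the
  key determines the term.
\<close>

definition weighted_lex :: "nat ^ 'n::finite \<Rightarrow> (nat \<Rightarrow> 'n) \<Rightarrow> 'n pterm rel" where
  "weighted_lex u e = {(a, b). a = b \<or> less_fun (weight_key u e a) (weight_key u e b)}"

lemma weight_add: "weight u (a + b) = weight u a + weight u b"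
  by (simp add: weight_def sum.distrib algebra_simps)

lemma weight_key_add: "weight_key u e (a + b) i = weight_key u e a i + weight_key u e b i"
  by (simp add: weight_key_def weight_add split: nat.split)

lemma weight_key_inject:
  fixes u :: "nat ^ 'n::finite"
  assumes "bij_betw e {..<CARD('n)} (UNIV :: 'n set)"
    and "weight_key u e a = weight_key u e b"
  shows "a = b"
proof -
  have "a $ j = b $ j" for j
  proof -
    obtain k where "k < CARD('n)" "e k = j"
      using assms(1) by (metis UNIV_I bij_betw_iff_bijections lessThan_iff)
    then show ?thesis using fun_cong[OF assms(2), of "Suc k"] by (auto simp: weight_key_def)
  qed
  then show ?thesis by (simp add: vec_eq_iff)
qed

lemma weighted_lex_weight_le:
  assumes "(a, b) \<in> weighted_lex u e"
  shows "weight u a \<le> weight u b"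
proof -
  have "weight_key u e a 0 \<le> weight_key u e b 0"
    using assms by (auto simp: weighted_lex_def less_fun_def) (metis gr0I less_imp_le order_refl)
  then show ?thesis by (simp add: weight_key_def)
qed

lemma weighted_lex_weight_less:
  assumes "weight u a < weight u b"
  shows "(a, b) \<in> weighted_lex u e"
  using assms by (auto simp: weighted_lex_def less_fun_def weight_key_def intro!: exI[of _ 0])

lemma finite_weight_le:
  fixes u :: "nat ^ 'n::finite"
  assumes "\<And>j. 0 < u $ j"
  shows "finite {a. weight u a \<le> N}"
proof (rule finite_subset)
  have "a $ j \<le> N" if "weight u a \<le> N" for a j
  proof -
    have "a $ j \<le> u $ j * a $ j" using assms[of j] by simp
    also have "\<dots> \<le> weight u a" unfolding weight_def by (rule member_le_sum) simp_all
    finally show ?thesis using that by simp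
  qed
  then show "{a. weight u a \<le> N} \<subseteq> vec_lambda ` (UNIV \<rightarrow>\<^sub>E {..N})"
    by (auto intro!: image_eqI[of _ _ "vec_nth _"])
  show "finite (vec_lambda ` ((UNIV :: 'n set) \<rightarrow>\<^sub>E {..N}))"
    by (intro finite_imageI finite_PiE) simp_all
qed

lemma term_ordering_weighted_lex:
  fixes u :: "nat ^ 'n::finite"
  assumes pos: "\<And>j. 0 < u $ j" and e: "bij_betw e {..<CARD('n)} (UNIV :: 'n set)"
  shows "term_ordering (weighted_lex u e)"
proof -
  let ?\<sigma> = "weighted_lex u e"
  let ?k = "weight_key u e"
  have refl: "refl ?\<sigma>" by (auto simp: refl_on_def weighted_lex_def)
  have trans: "trans ?\<sigma>"
    by (rule transI) (auto simp: weighted_lex_def intro: less_fun_trans)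
  have antisym: "antisym ?\<sigma>"
    by (rule antisymI) (auto simp: weighted_lex_def dest: less_fun_asym)
  have "total ?\<sigma>"
  proof (rule total_onI)
    fix a b :: "'n pterm" assume "a \<noteq> b"
    have "?k a i = ?k b i" if "CARD('n) < i" for i
      using that by (cases i) (auto simp: weight_key_def)
    then have "{i. ?k a i \<noteq> ?k b i} \<subseteq> {..CARD('n)}" by (auto simp: not_less[symmetric])
    then have "finite {i. ?k a i \<noteq> ?k b i}" by (rule finite_subset) simp
    then have "less_fun (?k a) (?k b) \<or> ?k a = ?k b \<or> less_fun (?k b) (?k a)"
      by (rule less_fun_trichotomy)
    then show "(a, b) \<in> ?\<sigma> \<or> (b, a) \<in> ?\<sigma>"
      using weight_key_inject[OF e] \<open>a \<noteq> b\<close> by (auto simp: weighted_lex_def)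
  qed
  moreover have "wf (?\<sigma> - Id)"
  proof -
    \<comment> \<open>Every term has only finitely many predecessors, so their number is a termination measure.\<close>
    have fin: "finite {c. (c, b) \<in> ?\<sigma>}" for b
      using finite_weight_le[of u "weight u b"] pos weighted_lex_weight_le[of _ b u e]
      by (auto intro: rev_finite_subset)
    have "card {c. (c, a) \<in> ?\<sigma>} < card {c. (c, b) \<in> ?\<sigma>}" if "(a, b) \<in> ?\<sigma> - Id" for a b
    proof (rule psubset_card_mono[OF fin])
      have "(b, a) \<notin> ?\<sigma>" using that antisymD[OF antisym] by blast
      then show "{c. (c, a) \<in> ?\<sigma>} \<subset> {c. (c, b) \<in> ?\<sigma>}"
        using that transD[OF trans] reflD[OF refl] by blast
    qed
    then have "?\<sigma> - Id \<subseteq> measure (\<lambda>b. card {c. (c, b) \<in> ?\<sigma>})"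
      by (intro subrelI) (simp only: in_measure)
    then show ?thesis using wf_measure wf_subset by blast
  qed
  moreover have "translation_compatible ?\<sigma>"
    by (auto simp: translation_compatible_def weighted_lex_def less_fun_def weight_key_add)
  ultimately show ?thesis
    using refl trans antisym by (simp add: term_ordering_def order_on_defs)
qed

lemma dot_to_int_vec_diff:
  "dot (to_int_vec u) (to_int_vec b - to_int_vec a) = int (weight u b) - int (weight u a)"
  by (simp add: dot_def weight_def to_int_vec_def sum_subtractf algebra_simps)

lemma dot_to_int_vec_indet: "dot u (to_int_vec (indet j)) = u $ j"
proof -
  have "dot u (to_int_vec (indet j)) = (\<Sum>i\<in>UNIV. if i = j then u $ i else 0)"
    unfolding dot_def by (rule sum.cong) (auto simp: to_int_vec_def indet_def axis_def)
  then show ?thesis by simp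
qed

section \<open>The characterization of separating tuples\<close>

theorem proposition3p3:
  fixes s :: nat
    and z :: "nat \<Rightarrow> 'n::finite pterm"
    and f :: "nat \<Rightarrow> ('n, 'k::field) polyn"
  assumes "1 \<le> s" and "s \<le> CARD('n)"
    and "\<forall>i\<in>{1..s}. z i \<in> range indet"
    and "inj_on z {1..s}"
    and "\<forall>i\<in>{1..s}. f i \<in> irrelevant_ideal - {0}"
    and "\<forall>i\<in>{1..s}. z i \<in> Supp (f i)"
  shows "(Z_separating s z f \<longleftrightarrow>
            (\<exists>\<sigma>. term_ordering \<sigma> \<and>
              (\<forall>v\<in>DLog s z f. (0, v) \<in> int_extension \<sigma> \<and> v \<noteq> 0)))
       \<and> ((\<exists>\<sigma>. term_ordering \<sigma> \<and>
              (\<forall>v\<in>DLog s z f. (0, v) \<in> int_extension \<sigma> \<and> v \<noteq> 0)) \<longleftrightarrow>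
            (\<exists>u :: nat ^ 'n. (\<forall>j. 0 < u $ j) \<and> (\<forall>v\<in>DLog s z f. 0 < dot (to_int_vec u) v)))"
    (is "(_ \<longleftrightarrow> ?B) \<and> (_ \<longleftrightarrow> ?C)")
proof (intro conjI iffI)
  have LT_iff: "(\<forall>i\<in>{1..s}. LT \<sigma> (f i) = z i) \<longleftrightarrow>
      (\<forall>v\<in>DLog s z f. (0, v) \<in> int_extension \<sigma> \<and> v \<noteq> 0)"
    if "term_ordering \<sigma>" for \<sigma>
  proof -
    have "LT \<sigma> (f i) = z i \<longleftrightarrow>
        (\<forall>v\<in>DLog_at (z i) (f i). (0, v) \<in> int_extension \<sigma> \<and> v \<noteq> 0)" if "i \<in> {1..s}" for i
      using LT_eq_iff_DLog_at_positive \<open>term_ordering \<sigma>\<close> assms(6) that by blast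
    then show ?thesis by (simp add: DLog_def)
  qed
  show ?B if "Z_separating s z f"
    using that LT_iff unfolding Z_separating_def by blast
  show "Z_separating s z f" if ?B
    using that LT_iff unfolding Z_separating_def by blast
next
  assume ?B
  then obtain \<sigma> where \<sigma>: "term_ordering \<sigma>"
    and pos: "\<And>v. v \<in> DLog s z f \<Longrightarrow> (0, v) \<in> int_extension \<sigma> \<and> v \<noteq> 0" by blast
  \<comment> \<open>The unit vectors are included in order to make every entry of \<open>u\<close> positive.\<close>
  let ?D = "DLog s z f \<union> range (\<lambda>j. to_int_vec (indet j))"
  have "(0, to_int_vec (indet j)) \<in> int_extension \<sigma> \<and> to_int_vec (indet j) \<noteq> 0" for j :: 'n
  proof -
    have "to_int_vec (0 :: 'n pterm) = 0" by (simp add: to_int_vec_def vec_eq_iff)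
    moreover have "indet j \<noteq> 0" by (simp add: indet_def)
    ultimately show ?thesis
      using int_extension_diff_iff[OF \<sigma>, of "indet j" 0] term_ordering_zero_least[OF \<sigma>]
        to_int_vec_inject[of "indet j" 0] by simp
  qed
  then have "(0, v) \<in> int_extension \<sigma> \<and> v \<noteq> 0" if "v \<in> ?D" for v
    using that by (elim UnE rangeE) (simp_all add: pos)
  moreover have "finite ?D" by (simp add: finite_DLog)
  ultimately obtain u where u: "\<And>v. v \<in> ?D \<Longrightarrow> 0 < dot u v"
    using ex_int_functional_positive[of "\<lambda>v. (0, v) \<in> int_extension \<sigma> \<and> v \<noteq> 0" ?D]
      int_extension_positive_add[OF \<sigma>] by blast
  have upos: "0 < u $ j" for j
    using u[of "to_int_vec (indet j)"] by (simp add: dot_to_int_vec_indet)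
  then have "to_int_vec (\<chi> j. nat (u $ j)) = u"
    by (simp add: to_int_vec_def vec_eq_iff less_imp_le)
  then show ?C using u upos by (intro exI[of _ "\<chi> j. nat (u $ j)"]) simp
next
  assume ?C
  then obtain u :: "nat ^ 'n" where u: "\<And>j. 0 < u $ j"
    and pos: "\<And>v. v \<in> DLog s z f \<Longrightarrow> 0 < dot (to_int_vec u) v" by blast
  obtain e where e: "bij_betw e {..<CARD('n)} (UNIV :: 'n set)"
    using ex_bij_betw_nat_finite[of "UNIV :: 'n set"] by (auto simp: atLeast0LessThan)
  note \<sigma> = term_ordering_weighted_lex[OF u e]
  have "(0, v) \<in> int_extension (weighted_lex u e) \<and> v \<noteq> 0" if "v \<in> DLog s z f" for v
  proof -
    obtain a b where v: "v = to_int_vec b - to_int_vec a" by (rule int_vec_diff_cases)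
    have "weight u a < weight u b" using pos[OF that] by (simp add: v dot_to_int_vec_diff)
    then show ?thesis
      using weighted_lex_weight_less int_extension_diff_iff[OF \<sigma>]
      by (auto simp: v to_int_vec_inject)
  qed
  with \<sigma> show ?B by blast
qed

end
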